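(* The quantity $H_n=H_n(t)$ satisfies the following second-order difference equation (in $n$): $$\begin{aligned}0={}&(2t+H_n-H_{n-1})^2(2t+H_{n+1}-H_n)^2(H_n+nH_{n-1}-nH_{n+1})\\&+\big[n(2t+H_n-H_{n-1})(2t+H_{n+1}-H_n)-2t(2nt+H_n)\big]\\&\times\big[(2t+H_n-H_{n-1})(2t+H_{n+1}-H_n)(2t-n-2\alpha+H_{n+1}-H_{n-1})+2t(2nt+H_n)\big],\end{aligned}$$ with the initial conditions $$H_1(t)=\frac{(1+2\alpha)\,\Phi\left(\frac12,\frac12+\alpha;-t\right)}{\Phi\left(\frac12,\frac32+\alpha;-t\right)},$$ $$H_2(t)=\frac{(1+2\alpha)\,\Phi\left(\frac12,\frac12+\alpha;-t\right)}{\Phi\left(\frac12,\frac32+\alpha;-t\right)}+\frac{(3+2\alpha)\,\Phi\left(\frac32,\frac32+\alpha;-t\right)}{\Phi\left(\frac32,\frac52+\alpha;-t\right)}.$$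
   Context: Let $\alpha>-1$, $t\in\mathbb{R}$ and $w(x,t)=(1-x^2)^{\alpha}e^{-tx^2}$ for $x\in[-1,1]$. Let $P_n(x,t)$, $n=0,1,2,\ldots$, be the monic polynomials of degree $n$ orthogonal with respect to $w$: $\int_{-1}^1P_m(x,t)P_n(x,t)w(x,t)\,dx=h_n(t)\delta_{mn}$. Define $$R_n(t):=\frac{2\alpha}{h_n(t)}\int_{-1}^1\frac{1}{1-y^2}P_n^2(y,t)\,w(y,t)\,dy,\qquad H_n(t):=\sum_{j=0}^{n-1}R_j(t).$$ $\Phi(a,b;z)=\sum_{k=0}^{\infty}\frac{(a)_k}{(b)_k}\frac{z^k}{k!}$ ($|z|<\infty$, $b\neq0,-1,-2,\ldots$) is Kummer's confluent hypergeometric function, where $(a)_0=1$ and $(a)_k=a(a+1)\cdots(a+k-1)$ for $k\ge1$.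
   Formalization: For -1 < α ≤ 0 the integral defining R_n diverges; there 2α∫… is read as its analytic continuation in α (integration by parts), while for α > 0 the formula is literal. The initial conditions are stated for α ≠ -1/2, where Φ(1/2,1/2+α;·) is defined. *)

theory Defs
  imports "HOL-Analysis.Analysis"
begin

definition weight :: "real \<Rightarrow> real \<Rightarrow> real \<Rightarrow> real" where
  "weight \<alpha> t x = (1 - x^2) powr \<alpha> * exp (- t * x^2)"

definition sqnorm :: "real \<Rightarrow> real \<Rightarrow> (nat \<Rightarrow> real poly) \<Rightarrow> nat \<Rightarrow> real" where
  "sqnorm \<alpha> t P n = integral {-1..1} (\<lambda>x. (poly (P n) x)^2 * weight \<alpha> t x)"

text \<open>
  Such a family exists and is unique whenever \<open>\<alpha> > -1\<close>; the parameters are fixed, so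
  \<open>P n\<close> stands for \<open>P\<^sub>n(\<cdot>, t)\<close> and \<open>sqnorm \<alpha> t P n\<close> for \<open>h\<^sub>n(t)\<close>.
\<close>

definition monic_orthogonal :: "real \<Rightarrow> real \<Rightarrow> (nat \<Rightarrow> real poly) \<Rightarrow> bool" where
  "monic_orthogonal \<alpha> t P \<longleftrightarrow>
     (\<forall>n. degree (P n) = n \<and> lead_coeff (P n) = 1) \<and>
     (\<forall>m n. integral {-1..1} (\<lambda>x. poly (P m) x * poly (P n) x * weight \<alpha> t x)
              = (if m = n then sqnorm \<alpha> t P n else 0))"

text \<open>
  For \<open>\<alpha> > 0\<close>, integrating the derivative of \<open>y g(y) (1 - y\<^sup>2)\<^sup>\<alpha>\<close> over \<open>[-1,1]\<close> gives
  \<open>2\<alpha> \<integral> g(y) (1 - y\<^sup>2)\<^bsup>\<alpha>-1\<^esup> dy = \<integral> ((1 + 2\<alpha>) g(y) + y g'(y)) (1 - y\<^sup>2)\<^sup>\<alpha> dy\<close>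
  for smooth \<open>g\<close>. The right-hand side converges and is analytic for \<open>\<alpha> > -1\<close>, hence is the
  analytic continuation in \<open>\<alpha>\<close> of the left-hand side, whose integral may diverge for \<open>\<alpha> \<le> 0\<close>.
\<close>

definition continued_integral :: "real \<Rightarrow> (real \<Rightarrow> real) \<Rightarrow> real" where
  "continued_integral \<alpha> g =
     integral {-1..1} (\<lambda>y. ((1 + 2 * \<alpha>) * g y + y * deriv g y) * (1 - y^2) powr \<alpha>)"

text \<open>
  The integral defining \<open>R\<^sub>n\<close> converges only for \<open>\<alpha> > 0\<close>. For \<open>-1 < \<alpha> \<le> 0\<close> the expression
  \<open>2\<alpha> \<integral> \<dots>\<close> is read as its analytic continuation in \<open>\<alpha>\<close>; the lemma
  \<open>continued_integral_eq\<close> below shows that both branches agree for \<open>\<alpha> > 0\<close>.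
\<close>

definition R :: "real \<Rightarrow> real \<Rightarrow> (nat \<Rightarrow> real poly) \<Rightarrow> nat \<Rightarrow> real" where
  "R \<alpha> t P n =
     (if \<alpha> > 0
      then 2 * \<alpha> / sqnorm \<alpha> t P n *
             integral {-1..1} (\<lambda>y. 1 / (1 - y^2) * (poly (P n) y)^2 * weight \<alpha> t y)
      else 1 / sqnorm \<alpha> t P n *
             continued_integral \<alpha> (\<lambda>y. (poly (P n) y)^2 * exp (- t * y^2)))"

definition H :: "real \<Rightarrow> real \<Rightarrow> (nat \<Rightarrow> real poly) \<Rightarrow> nat \<Rightarrow> real" where
  "H \<alpha> t P n = (\<Sum>j<n. R \<alpha> t P j)"

definition Kummer :: "real \<Rightarrow> real \<Rightarrow> real \<Rightarrow> real" where
  "Kummer a b z = (\<Sum>k. pochhammer a k / pochhammer b k * (z ^ k / fact k))"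

lemma continued_integral_eq:
  fixes g :: "real \<Rightarrow> real"
  assumes "\<alpha> > 0"
    and g: "\<And>y. y \<in> {-1..1} \<Longrightarrow> (g has_real_derivative g' y) (at y)"
    and g': "continuous_on {-1..1} g'"
  shows "((\<lambda>y. 2 * \<alpha> * (1 / (1 - y^2) * g y * (1 - y^2) powr \<alpha>))
           has_integral continued_integral \<alpha> g) {-1..1}"
proof -
  let ?w = "\<lambda>y::real. (1 - y^2) powr \<alpha>"
  let ?F = "\<lambda>y. y * g y * ?w y"
  let ?G = "\<lambda>y. ((1 + 2 * \<alpha>) * g y + y * g' y) * ?w y"
  let ?L = "\<lambda>y. 2 * \<alpha> * (1 / (1 - y^2) * g y * ?w y)"
  have cg: "continuous_on {-1..1} g"
    using g by (meson DERIV_isCont continuous_at_imp_continuous_on)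
  have cw: "continuous_on {-1..1} ?w"
    using assms(1)
    by (intro continuous_on_powr' continuous_intros) (auto simp: abs_square_le_1 abs_le_iff)
  have FTC: "((\<lambda>y. ?G y - ?L y) has_integral (?F 1 - ?F (-1))) {-1..1}"
  proof (rule fundamental_theorem_of_calculus_interior)
    show "continuous_on {-1..1} ?F"
      by (intro continuous_intros cg cw)
    fix y :: real assume y: "y \<in> {-1<..<1}"
    then have pos: "1 - y^2 > 0"
      by (simp add: abs_square_less_1 abs_less_iff)
    have powr_m1: "(1 - y^2) powr (\<alpha> - 1) = ?w y / (1 - y^2)"
      using pos by (simp add: powr_diff)
    have dw: "(?w has_real_derivative ?w y * (\<alpha> * (- 2 * y) / (1 - y^2))) (at y)"
      using pos by (auto intro!: derivative_eq_intros simp: powr_m1)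
    have dg: "(g has_real_derivative g' y) (at y)"
      using g y by simp
    have "(?F has_real_derivative
        (g y + y * g' y) * ?w y + y * g y * (?w y * (\<alpha> * (- 2 * y) / (1 - y^2)))) (at y)"
      by (rule derivative_eq_intros refl dw dg)+ (simp add: algebra_simps)
    moreover have "(g y + y * g' y) * ?w y + y * g y * (?w y * (\<alpha> * (- 2 * y) / (1 - y^2)))
        = ?G y - ?L y"
      using pos by (simp add: field_simps) (simp add: algebra_simps power2_eq_square)
    ultimately show "(?F has_vector_derivative ?G y - ?L y) (at y)"
      by (simp add: has_real_derivative_iff_has_vector_derivative)
  qed simp
  have "(?G has_integral integral {-1..1} ?G) {-1..1}"
    by (intro integrable_integral integrable_continuous_interval continuous_intros cg cw g')
  from has_integral_diff[OF this FTC]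
  have "(?L has_integral integral {-1..1} ?G) {-1..1}"
    by simp
  moreover have "integral {-1..1} ?G = continued_integral \<alpha> g"
    unfolding continued_integral_def
    by (rule integral_cong) (simp add: DERIV_imp_deriv[OF g])
  ultimately show ?thesis by simp
qed

end

theory Submission
  imports Defs
begin

text \<open>
  Write \<open>\<beta>\<^sub>n = h\<^sub>n / h\<^sub>n\<^sub>-\<^sub>1\<close> for the coefficients in
  \<open>x P\<^sub>n = P\<^sub>n\<^sub>+\<^sub>1 + \<beta>\<^sub>n P\<^sub>n\<^sub>-\<^sub>1\<close>; there is no middle term because the weight is even.
  Everything rests on expressing \<open>H\<^sub>n\<close> by these coefficients.

  The continued integral moves the singular factor \<open>1 / (1 - y\<^sup>2)\<close> onto the polynomial
  by parts, so that \<open>R\<^sub>n h\<^sub>n\<close> becomes the ordinary integral of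
  \<open>(1 + 2\<alpha>) P\<^sub>n\<^sup>2 + y (P\<^sub>n\<^sup>2)' - 2t y\<^sup>2 P\<^sub>n\<^sup>2\<close> against the weight, for every
  \<open>\<alpha> > -1\<close>. Orthogonality evaluates it
  (\<open>R_eq_weighted_integral\<close>, \<open>L_continued_integrand\<close>):
  \<open>R\<^sub>n = 2n + 1 + 2\<alpha> - 2t (\<beta>\<^sub>n + \<beta>\<^sub>n\<^sub>+\<^sub>1)\<close>.

  The coefficients satisfy one nonlinear recurrence. The weight obeys the Pearson equation,
  that is, \<open>(1 - x\<^sup>2) f w\<close> vanishes at the endpoints, and with
  \<open>f = P\<^sub>n P\<^sub>n\<^sub>+\<^sub>1\<close> this gives a relation between three consecutive coefficients and the
  sum \<open>\<beta>\<^sub>0 + \<dots> + \<beta>\<^sub>n\<close>. Subtracting neighbouring instances removes the sum and leaves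
  \<open>\<beta>\<^sub>n\<^sub>+\<^sub>1 Z\<^sub>n\<^sub>+\<^sub>1 - \<beta>\<^sub>n Z\<^sub>n\<^sub>-\<^sub>1 = 1\<close> with \<open>Z\<^sub>n = 2t + R\<^sub>n\<close>
  (\<open>recurrence_coefficients_equation\<close>).

  That recurrence has two first integrals, with \<open>r\<^sub>n = n - 2t \<beta>\<^sub>n\<close>:
  \<open>2nt + H\<^sub>n = \<beta>\<^sub>n Z\<^sub>n Z\<^sub>n\<^sub>-\<^sub>1\<close> and
  \<open>r\<^sub>n (r\<^sub>n + 2\<alpha>) = \<beta>\<^sub>n R\<^sub>n R\<^sub>n\<^sub>-\<^sub>1\<close>
  (\<open>product_identities_from_recurrence\<close>). Since
  \<open>Z\<^sub>n\<^sub>-\<^sub>1 = 2t + H\<^sub>n - H\<^sub>n\<^sub>-\<^sub>1\<close> and \<open>Z\<^sub>n = 2t + H\<^sub>n\<^sub>+\<^sub>1 - H\<^sub>n\<close>, the first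
  links \<open>\<beta>\<^sub>n\<close> to three neighbouring values of \<open>H\<close>. The difference equation is the second
  one multiplied by \<open>Z\<^sub>n\<^sup>2 Z\<^sub>n\<^sub>-\<^sub>1\<^sup>2\<close>, with \<open>\<beta>\<^sub>n Z\<^sub>n Z\<^sub>n\<^sub>-\<^sub>1\<close> replaced by \<open>2nt + H\<^sub>n\<close>.
  This last step uses no division, so it is valid
  also where some \<open>Z\<^sub>n\<close> vanishes.

  For the initial values, \<open>P\<^sub>0 = 1\<close> and \<open>P\<^sub>1 = x\<close> make \<open>R\<^sub>0\<close> and \<open>R\<^sub>1\<close> quotients of even
  moments of the weight. Expanding \<open>exp (- t x\<^sup>2)\<close> and integrating term by term turns
  these into Kummer series, because the moments of \<open>(1 - x\<^sup>2)\<^sup>\<alpha>\<close> are quotients of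
  Pochhammer symbols.
\<close>

section \<open>From the recurrence coefficients to the difference equation\<close>

text \<open>
  Both identities are telescoping sums of the recurrence. Multiplied by \<open>Z\<^sub>n\<close> it says that
  \<open>b\<^sub>n Z\<^sub>n Z\<^sub>n\<^sub>-\<^sub>1\<close> grows by \<open>Z\<^sub>n\<close>. For the second one, put \<open>r\<^sub>n = n - 2t b\<^sub>n\<close>; then
  \<open>Z\<^sub>n - 2t = r\<^sub>n + r\<^sub>n\<^sub>+\<^sub>1 + 2a\<close> is exactly the factor that splits off the increment of
  \<open>r (r + 2a)\<close>. The factor \<open>b 0 = 0\<close> hides the index \<open>0 - 1\<close> at \<open>n = 0\<close>.
\<close>

lemma product_identities_from_recurrence:
  fixes a t :: real and b S :: "nat \<Rightarrow> real"
  defines "Z \<equiv> \<lambda>n. 2 * real n + 1 + 2 * a + 2 * t - 2 * t * (b n + b (Suc n))"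
  assumes b0: "b 0 = 0"
    and S: "S 0 = 0" "\<And>n. S (Suc n) = S n + (Z n - 2 * t)"
    and step: "\<And>n. b (Suc n) * Z (Suc n) - b n * Z (n - 1) = 1"
  shows "2 * real n * t + S n = b n * Z n * Z (n - 1)"
    and "(real n - 2 * t * b n) * (real n - 2 * t * b n + 2 * a)
         = b n * (Z n - 2 * t) * (Z (n - 1) - 2 * t)"
proof -
  show "2 * real n * t + S n = b n * Z n * Z (n - 1)"
  proof (induction n)
    case 0
    then show ?case by (simp add: b0 S)
  next
    case (Suc n)
    have "2 * real (Suc n) * t + S (Suc n) = b n * Z n * Z (n - 1) + Z n"
      using Suc by (simp add: S algebra_simps)
    also have "\<dots> = Z n * (b n * Z (n - 1) + 1)" by (simp add: algebra_simps)
    also have "b n * Z (n - 1) + 1 = b (Suc n) * Z (Suc n)" using step[of n] by simp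
    finally show ?case by (simp add: algebra_simps)
  qed
  show "(real n - 2 * t * b n) * (real n - 2 * t * b n + 2 * a)
         = b n * (Z n - 2 * t) * (Z (n - 1) - 2 * t)"
  proof (induction n)
    case 0
    then show ?case by (simp add: b0)
  next
    case (Suc n)
    define r where "r = (\<lambda>n. real n - 2 * t * b n)"
    have Zr: "Z n - 2 * t = r n + r (Suc n) + 2 * a"
      by (simp add: Z_def r_def algebra_simps)
    have "r (Suc n) * (r (Suc n) + 2 * a)
        = r n * (r n + 2 * a) + (Z n - 2 * t) * (r (Suc n) - r n)"
      unfolding Zr by (simp add: algebra_simps)
    also have "\<dots> = (Z n - 2 * t) * (b n * (Z (n - 1) - 2 * t) + (r (Suc n) - r n))"
      using Suc unfolding r_def by (simp add: algebra_simps)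
    also have "b n * (Z (n - 1) - 2 * t) + (r (Suc n) - r n)
        = b (Suc n) * (Z (Suc n) - 2 * t)"
      using step[of n] by (simp add: r_def algebra_simps)
    finally show ?case by (simp add: r_def algebra_simps)
  qed
qed

text \<open>
  Substituting \<open>2nt + S = b X Y\<close> makes \<open>X\<^sup>2 Y\<^sup>2\<close> a common factor of the left-hand side,
  and the cofactor is the difference of the two sides of the second hypothesis.
\<close>

lemma difference_equation_from_products:
  fixes X Y n t a S b :: real
  assumes prod1: "2 * n * t + S = b * Y * X"
    and prod2: "(n - 2 * t * b) * (n - 2 * t * b + 2 * a) = b * (Y - 2 * t) * (X - 2 * t)"
  shows "X^2 * Y^2 * (S - n * (X + Y - 4 * t))
       + (n * X * Y - 2 * t * (2 * n * t + S))
         * (X * Y * (X + Y - 2 * t - n - 2 * a) + 2 * t * (2 * n * t + S)) = 0"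
proof -
  have S: "S = b * Y * X - 2 * n * t" using prod1 by simp
  have "X^2 * Y^2 * (S - n * (X + Y - 4 * t))
       + (n * X * Y - 2 * t * (2 * n * t + S))
         * (X * Y * (X + Y - 2 * t - n - 2 * a) + 2 * t * (2 * n * t + S))
      = X^2 * Y^2 * (b * (Y - 2 * t) * (X - 2 * t)
          - (n - 2 * t * b) * (n - 2 * t * b + 2 * a))"
    unfolding S by algebra
  then show ?thesis using prod2 by simp
qed

section \<open>Orthogonal polynomials for an even functional with a Pearson equation\<close>

definition X :: "real poly" where "X = [:0, 1:]"

lemma poly_X [simp]: "poly X x = x"
  by (simp add: X_def)

lemma pderiv_X [simp]: "pderiv X = 1"
  by (simp add: X_def pderiv_pCons)

lemma coeff_X_mult: "coeff (X * p) n = (if n = 0 then 0 else coeff p (n - 1))"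
  by (simp add: X_def coeff_pCons split: nat.split)

lemma X_pcompose: "pcompose X p = p"
  by (simp add: X_def pcompose_pCons)

text \<open>
  The polynomial part of the argument depends on the weight only through evenness and the Pearson
  equation \<open>((1 - x\<^sup>2) w)' = - (2 (1 + a) x + 2t x (1 - x\<^sup>2)) w\<close>, read here as a
  property of the functional \<open>f \<mapsto> \<integral> f w\<close>.
\<close>

locale even_pearson_functional =
  fixes L :: "real poly \<Rightarrow> real" and P :: "nat \<Rightarrow> real poly" and a t :: real
  assumes L_add: "L (p + q) = L p + L q"
    and L_smult: "L (smult c p) = c * L p"
    and L_reflect: "L (pcompose p (- X)) = L p"
    and pearson: "L ((1 - X^2) * pderiv p)
                  = L (smult (2 * (1 + a)) (X * p) + smult (2 * t) (X * (1 - X^2) * p))"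
    and degree_P: "degree (P n) = n"
    and lead_coeff_P: "coeff (P n) n = 1"
    and orthogonal: "m \<noteq> n \<Longrightarrow> L (P m * P n) = 0"
    and norm_nonzero: "L (P n * P n) \<noteq> 0"
begin

definition h :: "nat \<Rightarrow> real" where "h n = L (P n * P n)"

text \<open>
  The value at \<open>0\<close> is the usual convention: it makes the three-term recurrence hold at
  \<open>n = 0\<close> whatever polynomial stands for \<open>P\<^bsub>-1\<^esub>\<close>.
\<close>

definition b :: "nat \<Rightarrow> real" where "b n = (if n = 0 then 0 else h n / h (n - 1))"

lemma L_minus: "L (- p) = - L p"
  using L_smult[of "-1" p] by simp

lemma L_diff: "L (p - q) = L p - L q"
  using L_add[of p "- q"] L_minus[of q] by simp

lemma L_0: "L 0 = 0"
  using L_smult[of 0 0] by simp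

lemmas L_linear = L_add L_diff L_smult L_minus L_0

lemma h_nonzero: "h n \<noteq> 0"
  using norm_nonzero by (simp add: h_def)

lemma h_Suc: "h (Suc n) = b (Suc n) * h n"
  using h_nonzero[of n] by (simp add: b_def)

lemma coeff_P_above: "n < i \<Longrightarrow> coeff (P n) i = 0"
  by (simp add: coeff_eq_0 degree_P)

lemma L_mult_P_eq_0:
  assumes "\<And>i. d \<le> i \<Longrightarrow> coeff q i = 0" "d \<le> n"
  shows "L (q * P n) = 0"
  using assms
proof (induction d arbitrary: q)
  case 0
  then have "q = 0" by (simp add: poly_eq_iff)
  then show ?case by (simp add: L_0)
next
  case (Suc d)
  define q' where "q' = q - smult (coeff q d) (P d)"
  have "coeff q' i = 0" if "d \<le> i" for i
    using that Suc.prems(1)[of i] coeff_P_above[of d i]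
    by (cases "i = d") (auto simp: q'_def lead_coeff_P)
  then have "L (q' * P n) = 0" using Suc by simp
  moreover have "L (smult (coeff q d) (P d) * P n) = 0"
    using orthogonal[of d n] Suc.prems(2) by (simp add: L_smult)
  ultimately show ?case by (simp add: q'_def algebra_simps L_linear)
qed

lemma L_mult_P:
  assumes "\<And>i. n < i \<Longrightarrow> coeff q i = 0"
  shows "L (q * P n) = coeff q n * h n"
proof -
  define q' where "q' = q - smult (coeff q n) (P n)"
  have "coeff q' i = 0" if "n \<le> i" for i
    using that assms[of i] coeff_P_above[of n i]
    by (cases "i = n") (auto simp: q'_def lead_coeff_P)
  then have "L (q' * P n) = 0" by (rule L_mult_P_eq_0) auto
  then show ?thesis by (simp add: q'_def algebra_simps L_linear h_def)
qed

text \<open>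
  Pairing \<open>q\<close> with the \<open>P k\<close> of its own degree gives the leading coefficient of \<open>q\<close> times
  a nonzero norm. Parity and the three-term recurrence below both follow from this uniqueness.
\<close>

lemma eq_0_if_orthogonal:
  assumes "\<And>i. n \<le> i \<Longrightarrow> coeff q i = 0" "\<And>k. k < n \<Longrightarrow> L (q * P k) = 0"
  shows "q = 0"
proof (rule ccontr)
  assume "q \<noteq> 0"
  then have lc: "coeff q (degree q) \<noteq> 0" by simp
  then have "degree q < n" using assms(1) not_le by blast
  then have "L (q * P (degree q)) = 0" by (rule assms(2))
  moreover have "L (q * P (degree q)) = coeff q (degree q) * h (degree q)"
    by (rule L_mult_P) (simp add: coeff_eq_0)
  ultimately show False using lc h_nonzero by simp
qed

lemma coeff_reflect: "coeff (pcompose p (- X)) n = (- 1) ^ n * coeff p n"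
proof (induction p arbitrary: n)
  case (pCons c p)
  have "pcompose (pCons c p) (- X) = [:c:] - X * pcompose p (- X)"
    by (simp add: pcompose_pCons)
  then show ?case
    by (cases n) (simp_all add: coeff_X_mult pCons)
qed simp

text \<open>
  The reflected polynomial, normalised to be monic, is again orthogonal to all lower degrees, since
  \<open>L\<close> is even.
\<close>

lemma P_reflect: "pcompose (P n) (- X) = smult ((- 1) ^ n) (P n)"
proof -
  define q where "q = smult ((- 1) ^ n) (pcompose (P n) (- X)) - P n"
  have refl2: "pcompose (pcompose p (- X)) (- X) = p" for p
    by (rule poly_eqI) (simp add: coeff_reflect flip: mult.assoc power_add mult_2)
  have "q = 0"
  proof (rule eq_0_if_orthogonal)
    fix i assume "n \<le> i"
    then show "coeff q i = 0"
      using coeff_P_above[of n i]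
      by (cases "i = n")
        (auto simp: q_def coeff_reflect lead_coeff_P simp flip: power_add mult_2)
  next
    fix k assume "k < n"
    have "L (pcompose (P n) (- X) * P k) = L (pcompose (pcompose (P k) (- X) * P n) (- X))"
      by (simp add: pcompose_mult refl2 mult.commute)
    also have "\<dots> = L (pcompose (P k) (- X) * P n)" by (rule L_reflect)
    also have "\<dots> = 0"
      using \<open>k < n\<close> coeff_P_above[of k]
      by (intro L_mult_P_eq_0[of "Suc k"]) (auto simp: coeff_reflect)
    finally have "L (pcompose (P n) (- X) * P k) = 0" .
    then show "L (q * P k) = 0"
      using orthogonal[of n k] \<open>k < n\<close> by (simp add: q_def L_linear left_diff_distrib)
  qed
  then have "P n = smult ((- 1) ^ n) (pcompose (P n) (- X))" by (simp add: q_def)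
  then have "smult ((- 1) ^ n) (P n) = smult ((- 1) ^ n * (- 1) ^ n) (pcompose (P n) (- X))"
    by (metis smult_smult)
  then show ?thesis by (simp flip: power_add mult_2)
qed

lemma L_X_P_P: "L (X * P n * P n) = 0"
proof -
  have "L (X * P n * P n) = L (pcompose (X * P n * P n) (- X))"
    by (rule L_reflect[symmetric])
  also have "pcompose (X * P n * P n) (- X) = smult ((- 1) ^ (n + n)) (- (X * P n * P n))"
    by (simp add: pcompose_mult X_pcompose P_reflect power_add)
  also have "\<dots> = - (X * P n * P n)" by (simp flip: mult_2)
  finally show ?thesis by (simp add: L_minus)
qed

lemma three_term_recurrence: "X * P n = P (Suc n) + smult (b n) (P (n - 1))"
proof -
  define q where "q = X * P n - P (Suc n) - smult (b n) (P (n - 1))"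
  have "q = 0"
  proof (rule eq_0_if_orthogonal)
    fix i assume i: "Suc n \<le> i"
    then show "coeff q i = 0"
      using coeff_P_above[of n "i - 1"] coeff_P_above[of "Suc n" i] coeff_P_above[of "n - 1" i]
      by (cases "i = Suc n") (auto simp: q_def coeff_X_mult lead_coeff_P)
  next
    fix k assume k: "k < Suc n"
    have 1: "L (P (Suc n) * P k) = 0" using k orthogonal[of "Suc n" k] by simp
    consider "k = n" | "Suc k = n" | "Suc k < n" using k by linarith
    then have "L (X * P n * P k) = b n * L (P (n - 1) * P k)"
    proof cases
      case 1
      then show ?thesis using L_X_P_P[of n] orthogonal[of "n - 1" n]
        by (cases n) (auto simp: b_def)
    next
      case 2
      have "L (X * P n * P k) = L ((X * P k) * P n)" by (simp add: ac_simps)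
      also have "\<dots> = coeff (X * P k) n * h n"
        using 2 coeff_P_above[of k] by (intro L_mult_P) (auto simp: coeff_X_mult)
      also have "\<dots> = h n" using 2 by (auto simp: coeff_X_mult lead_coeff_P)
      finally show ?thesis using 2 h_Suc[of k] by (auto simp: h_def)
    next
      case 3
      have "L (X * P n * P k) = L ((X * P k) * P n)" by (simp add: ac_simps)
      also have "\<dots> = 0"
        using 3 coeff_P_above[of k]
        by (intro L_mult_P_eq_0[of "Suc (Suc k)"]) (auto simp: coeff_X_mult)
      finally show ?thesis using 3 orthogonal[of "n - 1" k] by simp
    qed
    with 1 show "L (q * P k) = 0" by (simp add: q_def L_linear left_diff_distrib)
  qed
  then show ?thesis by (simp add: q_def algebra_simps)
qed

lemma L_X_P_P_Suc: "L (X * P n * P (Suc n)) = h (Suc n)"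
  using orthogonal[of "n - 1" "Suc n"] unfolding three_term_recurrence
  by (simp add: algebra_simps L_linear h_def)

lemma L_X2_P_P: "L (X^2 * P n * P n) = (b n + b (Suc n)) * h n"
proof -
  have "X^2 * P n * P n = (X * P n) * (X * P n)" by (simp add: power2_eq_square ac_simps)
  also have "L \<dots> = L (X * P n * P (Suc n)) + b n * L (X * P n * P (n - 1))"
    by (subst (2) three_term_recurrence) (simp add: distrib_left L_linear)
  also have "b n * L (X * P n * P (n - 1)) = b n * h n"
    using L_X_P_P_Suc[of "n - 1"] by (cases n) (simp_all add: b_def ac_simps)
  finally show ?thesis using L_X_P_P_Suc[of n] by (simp add: h_Suc algebra_simps)
qed

lemma L_X3_P_P_Suc: "L (X^3 * P n * P (Suc n)) = (b n + b (Suc n) + b (Suc (Suc n))) * h (Suc n)"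
proof -
  have "X^3 * P n * P (Suc n) = (X * P n) * (X^2 * P (Suc n))"
    by (simp add: power2_eq_square power3_eq_cube ac_simps)
  also have "L \<dots> = L (X^2 * P (Suc n) * P (Suc n)) + b n * L (X^2 * P (n - 1) * P (Suc n))"
    unfolding three_term_recurrence by (simp add: algebra_simps L_linear)
  also have "b n * L (X^2 * P (n - 1) * P (Suc n)) = b n * h (Suc n)"
  proof (cases n)
    case (Suc m)
    have "L (X^2 * P m * P (Suc n)) = L ((X * (X * P m)) * P (Suc n))"
      by (simp add: power2_eq_square ac_simps)
    also have "\<dots> = coeff (X * (X * P m)) (Suc n) * h (Suc n)"
      by (intro L_mult_P) (auto simp: coeff_X_mult coeff_P_above Suc)
    also have "coeff (X * (X * P m)) (Suc n) = 1"
      by (simp add: coeff_X_mult Suc lead_coeff_P)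
    finally show ?thesis by (simp add: Suc)
  qed (simp add: b_def)
  finally show ?thesis using L_X2_P_P[of "Suc n"] by (simp add: algebra_simps)
qed

lemma L_X_pderiv_P_P: "L (X * pderiv (P n) * P n) = real n * h n"
proof -
  have "L (X * pderiv (P n) * P n) = coeff (X * pderiv (P n)) n * h n"
    by (intro L_mult_P) (auto simp: coeff_X_mult coeff_pderiv coeff_P_above)
  then show ?thesis by (cases n) (simp_all add: coeff_X_mult coeff_pderiv lead_coeff_P)
qed

lemma L_pderiv_P_Suc_P: "L (pderiv (P (Suc n)) * P n) = real (Suc n) * h n"
proof -
  have "L (pderiv (P (Suc n)) * P n) = coeff (pderiv (P (Suc n))) n * h n"
    by (intro L_mult_P) (auto simp: coeff_pderiv coeff_P_above)
  then show ?thesis by (simp add: coeff_pderiv lead_coeff_P)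
qed

lemma L_pderiv_P_P_Suc: "L (pderiv (P n) * P (Suc n)) = 0"
  by (intro L_mult_P_eq_0[of n]) (auto simp: coeff_pderiv coeff_P_above)

lemma L_X2_pderiv_P_P_Suc: "L (X^2 * pderiv (P n) * P (Suc n)) = real n * h (Suc n)"
proof -
  have "L (X^2 * pderiv (P n) * P (Suc n)) = L ((X * (X * pderiv (P n))) * P (Suc n))"
    by (simp add: power2_eq_square ac_simps)
  also have "\<dots> = coeff (X * (X * pderiv (P n))) (Suc n) * h (Suc n)"
    by (intro L_mult_P) (auto simp: coeff_X_mult coeff_pderiv coeff_P_above)
  also have "coeff (X * (X * pderiv (P n))) (Suc n) = real n"
    by (cases n) (simp_all add: coeff_X_mult coeff_pderiv lead_coeff_P)
  finally show ?thesis .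
qed

text \<open>
  Here the projection of \<open>X\<^sup>2 P\<^sub>n\<^sub>+\<^sub>1'\<close> onto \<open>P\<^sub>n\<close> is two degrees below the leading term, so it
  involves the second coefficient of \<open>P\<^sub>n\<^sub>+\<^sub>1\<close>; that is where the sum of the \<open>b j\<close>
  comes from. The induction applies the three-term recurrence to the undifferentiated factor and
  its derivative to the other.
\<close>

lemma L_X2_pderiv_P_Suc_P:
  "L (X^2 * pderiv (P (Suc n)) * P n) = (real (Suc n) * b (Suc n) + 2 * (\<Sum>j\<le>n. b j)) * h n"
proof (induction n)
  case 0
  have "P (Suc 0) = X * P 0" "pderiv (P 0) = 0"
    using three_term_recurrence[of 0] degree_P[of 0]
    by (auto simp: b_def pderiv_eq_0_iff)
  then have "pderiv (P (Suc 0)) = P 0" by (simp add: pderiv_mult)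
  then show ?case using L_X2_P_P[of 0] by (simp add: b_def)
next
  case (Suc n)
  let ?n' = "Suc n" and ?n'' = "Suc (Suc n)"
  have rec: "P ?n'' = X * P ?n' - smult (b ?n') (P n)"
    using three_term_recurrence[of ?n'] by simp
  have "L (X^2 * pderiv (P ?n'') * P ?n') = L ((X * pderiv (P ?n'')) * (X * P ?n'))"
    by (simp add: power2_eq_square ac_simps)
  also have "\<dots> = L (X * pderiv (P ?n'') * P ?n'') + b ?n' * L (X * pderiv (P ?n'') * P n)"
    using three_term_recurrence[of ?n'] by (simp add: algebra_simps L_linear)
  also have "L (X * pderiv (P ?n'') * P n)
      = L (X * P n * P ?n') + L (X^2 * pderiv (P ?n') * P n) - b ?n' * L (X * pderiv (P n) * P n)"
    unfolding rec
    by (simp add: pderiv_diff pderiv_mult pderiv_smult algebra_simps L_linear power2_eq_square)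
  finally show ?case
    unfolding Suc L_X_P_P_Suc L_X_pderiv_P_P by (simp add: h_Suc algebra_simps)
qed

text \<open>
  The Pearson equation tested with \<open>P\<^sub>n P\<^sub>n\<^sub>+\<^sub>1\<close>. For an even test function both of its sides
  would be integrals of odd functions and hence zero.
\<close>

lemma recurrence_coefficients_sum_equation:
  "real (Suc n) - 2 * (\<Sum>j\<le>n. b j)
   = b (Suc n) * (2 * real n + 3 + 2 * a + 2 * t
                  - 2 * t * (b n + b (Suc n) + b (Suc (Suc n))))"
proof -
  have "L ((1 - X^2) * pderiv (P n * P (Suc n)))
      = L (pderiv (P (Suc n)) * P n) - L (X^2 * pderiv (P (Suc n)) * P n)
        + L (pderiv (P n) * P (Suc n)) - L (X^2 * pderiv (P n) * P (Suc n))"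
    by (simp add: pderiv_mult algebra_simps L_linear)
  moreover have "L (smult (2 * (1 + a)) (X * (P n * P (Suc n)))
                   + smult (2 * t) (X * (1 - X^2) * (P n * P (Suc n))))
      = 2 * (1 + a + t) * L (X * P n * P (Suc n)) - 2 * t * L (X^3 * P n * P (Suc n))"
    by (simp add: algebra_simps L_linear power2_eq_square power3_eq_cube)
  ultimately have "h n * (real (Suc n) - 2 * (\<Sum>j\<le>n. b j)) = h n *
      (b (Suc n) * (2 * real n + 3 + 2 * a + 2 * t
                  - 2 * t * (b n + b (Suc n) + b (Suc (Suc n)))))"
    using pearson[of "P n * P (Suc n)"]
    unfolding L_pderiv_P_Suc_P L_X2_pderiv_P_Suc_P L_pderiv_P_P_Suc L_X2_pderiv_P_P_Suc
      L_X_P_P_Suc L_X3_P_P_Suc h_Suc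
    by (simp add: algebra_simps)
  then show ?thesis using h_nonzero by simp
qed

lemma recurrence_coefficients_equation:
  defines "Z \<equiv> \<lambda>n. 2 * real n + 1 + 2 * a + 2 * t - 2 * t * (b n + b (Suc n))"
  shows "b (Suc n) * Z (Suc n) - b n * Z (n - 1) = 1"
proof (cases n)
  case 0
  then show ?thesis
    using recurrence_coefficients_sum_equation[of 0] by (simp add: Z_def b_def algebra_simps)
next
  case (Suc m)
  then show ?thesis
    using recurrence_coefficients_sum_equation[of n] recurrence_coefficients_sum_equation[of m]
    by (simp add: Z_def algebra_simps)
qed

text \<open>
  For the weight functional the left-hand side is \<open>R\<^sub>n h\<^sub>n\<close>.
\<close>

lemma L_continued_integrand:
  "L (smult (1 + 2 * a) (P n * P n) + X * pderiv (P n * P n) - smult (2 * t) (X^2 * P n * P n))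
   = (2 * real n + 1 + 2 * a - 2 * t * (b n + b (Suc n))) * h n"
proof -
  have "pderiv (P n * P n) = smult 2 (pderiv (P n) * P n)"
    using smult_add_left[of 1 1 "pderiv (P n) * P n"] by (simp add: pderiv_mult mult.commute)
  then have "L (smult (1 + 2 * a) (P n * P n) + X * pderiv (P n * P n) - smult (2 * t) (X^2 * P n * P n))
      = (1 + 2 * a) * h n + 2 * L (X * pderiv (P n) * P n) - 2 * t * L (X^2 * P n * P n)"
    by (simp add: L_linear h_def mult.assoc)
  then show ?thesis
    unfolding L_X_pderiv_P_P L_X2_P_P by (simp only:) (simp add: algebra_simps)
qed

end

section \<open>The weight as a functional on polynomials\<close>

text \<open>
  The substitution \<open>x = 2u - 1\<close> gives \<open>1 - x\<^sup>2 = 4u (1 - u)\<close> and hence a Beta integral.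
\<close>

lemma absolutely_integrable_Gegenbauer_weight:
  fixes a :: real
  assumes "a > -1"
  shows "(\<lambda>x. (1 - x^2) powr a) absolutely_integrable_on {-1..1::real}"
proof -
  have "((\<lambda>u. u powr a * (1 - u) powr a) has_integral Beta (a + 1) (a + 1)) (cbox 0 (1::real))"
    using has_integral_Beta_real[of "a + 1" "a + 1"] assms by simp
  from has_integral_affinity'[OF this, of "1/2" "1/2"]
  have "(\<lambda>x. (x/2 + 1/2) powr a * (1 - (x/2 + 1/2)) powr a) integrable_on {-1..1::real}"
    by (auto simp: integrable_on_def)
  then have "(\<lambda>x. 4 powr a * ((x/2 + 1/2) powr a * (1 - (x/2 + 1/2)) powr a)) integrable_on {-1..1::real}"
    by (rule integrable_on_mult_right)
  moreover have "4 powr a * ((x/2 + 1/2) powr a * (1 - (x/2 + 1/2)) powr a) = (1 - x^2) powr a"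
    if "x \<in> {-1..1}" for x :: real
  proof -
    have "(1 - x^2) = 4 * ((x/2 + 1/2) * (1 - (x/2 + 1/2)))"
      by (simp add: field_simps power2_eq_square)
    then show ?thesis using that by (simp add: powr_mult)
  qed
  ultimately have "(\<lambda>x. (1 - x^2) powr a) integrable_on {-1..1::real}"
    by (rule integrable_eq) auto
  then show ?thesis by (rule nonnegative_absolutely_integrable_1) simp
qed

lemma integrable_mult_weight:
  assumes "a > -1" and f: "continuous_on {-1..1} f"
  shows "(\<lambda>x. f x * weight a t x) integrable_on {-1..1}"
proof -
  have c: "continuous_on {-1..1} (\<lambda>x. f x * exp (- t * x^2))"
    by (intro continuous_intros f)
  have "(\<lambda>x. (f x * exp (- t * x^2)) * (1 - x^2) powr a) absolutely_integrable_on {-1..1}"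
  proof (rule absolutely_integrable_bounded_measurable_product_real)
    show "(\<lambda>x. f x * exp (- t * x^2)) \<in> borel_measurable (lebesgue_on {-1..1})"
      using c by (rule continuous_imp_measurable_on_sets_lebesgue) simp
    show "bounded ((\<lambda>x. f x * exp (- t * x^2)) ` {-1..1})"
      using c by (intro compact_imp_bounded compact_continuous_image) auto
  qed (use absolutely_integrable_Gegenbauer_weight assms in auto)
  then have "(\<lambda>x. (f x * exp (- t * x^2)) * (1 - x^2) powr a) integrable_on {-1..1}"
    by (rule set_lebesgue_integral_eq_integral(1))
  then show ?thesis by (simp add: weight_def ac_simps)
qed

definition weighted_integral :: "real \<Rightarrow> real \<Rightarrow> real poly \<Rightarrow> real" where
  "weighted_integral a t p = integral {-1..1} (\<lambda>x. poly p x * weight a t x)"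

lemma has_integral_weighted_integral:
  assumes "a > -1"
  shows "((\<lambda>x. poly p x * weight a t x) has_integral weighted_integral a t p) {-1..1}"
  unfolding weighted_integral_def
  by (intro integrable_integral integrable_mult_weight assms continuous_intros)

lemma weighted_integral_add:
  assumes "a > -1"
  shows "weighted_integral a t (p + q) = weighted_integral a t p + weighted_integral a t q"
proof (rule has_integral_unique[OF has_integral_weighted_integral[OF assms]])
  have "((\<lambda>x. poly p x * weight a t x + poly q x * weight a t x)
      has_integral weighted_integral a t p + weighted_integral a t q) {-1..1}"
    by (rule has_integral_add[OF has_integral_weighted_integral[OF assms]
          has_integral_weighted_integral[OF assms]])
  then show "((\<lambda>x. poly (p + q) x * weight a t x)
      has_integral weighted_integral a t p + weighted_integral a t q) {-1..1}"
    by (simp add: distrib_right)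
qed

lemma weighted_integral_smult:
  "weighted_integral a t (smult c p) = c * weighted_integral a t p"
  by (simp add: weighted_integral_def mult.assoc)

lemma weighted_integral_reflect:
  "weighted_integral a t (pcompose p (- X)) = weighted_integral a t p"
  using Henstock_Kurzweil_Integration.integral_reflect_real[of 1 "-1" "\<lambda>x. poly p x * weight a t x"]
  by (simp add: weighted_integral_def poly_pcompose weight_def)

text \<open>
  For \<open>a < 0\<close> the weight is unbounded at the endpoints; positivity is therefore read off on the
  inner interval, where the integrand is continuous.
\<close>

lemma weighted_integral_square_pos:
  assumes "a > -1" "p \<noteq> 0"
  shows "weighted_integral a t (p * p) > 0"
proof -
  let ?f = "\<lambda>x. poly (p * p) x * weight a t x"
  have cont: "continuous_on {-1/2..1/2} ?f"
  proof -
    have "1 - x^2 \<noteq> 0" if "x \<in> {-1/2..1/2}" for x :: real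
      using that abs_square_less_1[of x] by auto
    then show ?thesis unfolding weight_def by (intro continuous_intros) auto
  qed
  have nonneg: "?f x \<ge> 0" for x by (simp add: weight_def)
  have "integral {-1/2..1/2} ?f \<noteq> 0"
  proof
    assume "integral {-1/2..1/2} ?f = 0"
    then have "\<forall>x\<in>{-1/2..1/2}. ?f x = 0"
      using integral_eq_0_iff[OF cont] nonneg by simp
    moreover have "weight a t x \<noteq> 0" if "x \<in> {-1/2..1/2}" for x
      using that abs_square_less_1[of x] by (auto simp: weight_def)
    ultimately have "{-1/2..1/2} \<subseteq> {x. poly p x = 0}" by auto
    then have "finite {-1/2..1/2::real}"
      using poly_roots_finite[OF assms(2)] finite_subset by blast
    then show False by (simp add: infinite_Icc)
  qed
  moreover have "integral {-1/2..1/2} ?f \<ge> 0"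
    using nonneg cont by (intro integral_nonneg integrable_continuous_interval)
  moreover have "integral {-1/2..1/2} ?f \<le> integral {-1..1} ?f"
  proof (rule integral_subset_le)
    show "?f integrable_on {-1/2..1/2}" by (rule integrable_continuous_interval[OF cont])
    show "?f integrable_on {-1..1}"
      using has_integral_weighted_integral[OF assms(1)] by (rule has_integral_integrable)
  qed (use nonneg in auto)
  ultimately show ?thesis by (simp add: weighted_integral_def)
qed

text \<open>
  The extra factor \<open>1 - x\<^sup>2\<close> raises the exponent to \<open>a + 1 > 0\<close>, so the antiderivative
  \<open>p (1 - x\<^sup>2) w\<close> is continuous on the closed interval and vanishes at both ends.
\<close>

lemma weighted_integral_pearson:
  assumes "a > -1"
  shows "weighted_integral a t ((1 - X^2) * pderiv p)
       = weighted_integral a t (smult (2 * (1 + a)) (X * p) + smult (2 * t) (X * (1 - X^2) * p))"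
proof -
  let ?F = "\<lambda>x. poly p x * exp (- t * x^2) * (1 - x^2) powr (a + 1)"
  let ?p = "(1 - X^2) * pderiv p"
  let ?q = "smult (2 * (1 + a)) (X * p) + smult (2 * t) (X * (1 - X^2) * p)"
  let ?f = "\<lambda>x. poly ?p x * weight a t x - poly ?q x * weight a t x"
  have "(?f has_integral ?F 1 - ?F (-1)) {-1..1}"
  proof (rule fundamental_theorem_of_calculus_interior)
    show "continuous_on {-1..1} ?F"
      using assms
      by (intro continuous_intros continuous_on_powr') (auto simp: abs_square_le_1 abs_le_iff)
    fix x :: real assume x: "x \<in> {-1<..<1}"
    then have pos: "1 - x^2 > 0" by (simp add: abs_square_less_1 abs_less_iff)
    have "(?F has_real_derivative
        (poly (pderiv p) x * exp (- t * x^2) + poly p x * (exp (- t * x^2) * (- t * (2 * x))))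
          * (1 - x^2) powr (a + 1)
        + poly p x * exp (- t * x^2) * ((a + 1) * (1 - x^2) powr a * (- 2 * x))) (at x)"
      using pos by (auto intro!: derivative_eq_intros simp: algebra_simps)
    moreover have eq: "(1 - x^2) powr (a + 1) = (1 - x^2) powr a * (1 - x^2)"
      using pos by (simp add: powr_add)
    have "(poly (pderiv p) x * exp (- t * x^2) + poly p x * (exp (- t * x^2) * (- t * (2 * x))))
          * (1 - x^2) powr (a + 1)
        + poly p x * exp (- t * x^2) * ((a + 1) * (1 - x^2) powr a * (- 2 * x)) = ?f x"
    proof -
      have "(p' * E + p * (E * (- t * (2 * x)))) * (W * (1 - x^2)) + p * E * ((a + 1) * W * (- 2 * x))
          = (1 - x^2) * p' * (W * E) - (2 * (1 + a) * (x * p) + 2 * t * (x * (1 - x^2) * p)) * (W * E)"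
        for p' p E W :: real by (simp add: algebra_simps power2_eq_square)
      then show ?thesis
        unfolding eq
        by (simp only: weight_def poly_mult poly_diff poly_1 poly_power poly_X poly_add poly_smult)
    qed
    ultimately have "(?F has_real_derivative ?f x) (at x)" by simp
    then show "(?F has_vector_derivative ?f x) (at x)"
      by (simp add: has_real_derivative_iff_has_vector_derivative)
  qed simp
  moreover have "(?f has_integral weighted_integral a t ?p - weighted_integral a t ?q) {-1..1}"
    by (intro has_integral_diff has_integral_weighted_integral assms)
  ultimately have "?F 1 - ?F (-1) = weighted_integral a t ?p - weighted_integral a t ?q"
    by (rule has_integral_unique)
  moreover have "?F 1 = 0" "?F (-1) = 0" by simp_all
  ultimately show ?thesis by simp
qed

lemma even_pearson_functional_weighted_integral:
  assumes a: "a > -1" and P: "monic_orthogonal a t P"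
  shows "even_pearson_functional (weighted_integral a t) P a t"
proof
  fix n m p q c
  show "weighted_integral a t (p + q) = weighted_integral a t p + weighted_integral a t q"
    by (rule weighted_integral_add[OF a])
  show "weighted_integral a t (smult c p) = c * weighted_integral a t p"
    by (rule weighted_integral_smult)
  show "weighted_integral a t (pcompose p (- X)) = weighted_integral a t p"
    by (rule weighted_integral_reflect)
  show "weighted_integral a t ((1 - X^2) * pderiv p)
      = weighted_integral a t (smult (2 * (1 + a)) (X * p) + smult (2 * t) (X * (1 - X^2) * p))"
    by (rule weighted_integral_pearson[OF a])
  have deg: "degree (P n) = n" and lc: "lead_coeff (P n) = 1"
    using P unfolding monic_orthogonal_def by blast+
  show "degree (P n) = n" by (rule deg)
  show monic: "coeff (P n) n = 1" using lc unfolding deg .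
  have "P n \<noteq> 0" using monic by auto
  then show "weighted_integral a t (P n * P n) \<noteq> 0"
    using weighted_integral_square_pos[OF a, of "P n" t] by simp
  show "weighted_integral a t (P m * P n) = 0" if "m \<noteq> n"
    using P that by (simp add: monic_orthogonal_def weighted_integral_def)
qed

text \<open>
  The two branches in the definition of \<open>R\<close> become one formula: for \<open>a > 0\<close> by
  \<open>continued_integral_eq\<close>, otherwise by definition.
\<close>

lemma R_eq_weighted_integral:
  assumes "a > -1"
  shows "R a t P n = weighted_integral a t
           (smult (1 + 2 * a) (P n * P n) + X * pderiv (P n * P n)
            - smult (2 * t) (X^2 * P n * P n)) / weighted_integral a t (P n * P n)"
proof -
  let ?p = "P n * P n"
  let ?g = "\<lambda>y. (poly (P n) y)^2 * exp (- t * y^2)"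
  let ?g' = "\<lambda>y. poly (pderiv ?p) y * exp (- t * y^2) - 2 * t * y * poly ?p y * exp (- t * y^2)"
  have g': "(?g has_real_derivative ?g' y) (at y)" for y
    by (auto intro!: derivative_eq_intros simp: pderiv_mult algebra_simps power2_eq_square)
  have sq: "sqnorm a t P n = weighted_integral a t ?p"
    by (simp add: sqnorm_def weighted_integral_def power2_eq_square)
  have cont: "continued_integral a ?g = weighted_integral a t
           (smult (1 + 2 * a) ?p + X * pderiv ?p - smult (2 * t) (X^2 * P n * P n))"
    unfolding continued_integral_def weighted_integral_def DERIV_imp_deriv[OF g']
    by (rule integral_cong) (simp add: weight_def algebra_simps power2_eq_square)
  have "R a t P n = continued_integral a ?g / sqnorm a t P n"
  proof (cases "a > 0")
    case True
    have "((\<lambda>y. 2 * a * (1 / (1 - y^2) * ?g y * (1 - y^2) powr a))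
           has_integral continued_integral a ?g) {-1..1}"
      by (rule continued_integral_eq[OF True g']) (intro continuous_intros)
    then have "integral {-1..1} (\<lambda>y. 2 * a * (1 / (1 - y^2) * ?g y * (1 - y^2) powr a))
        = continued_integral a ?g"
      by (rule integral_unique)
    then have "2 * a * integral {-1..1} (\<lambda>y. 1 / (1 - y^2) * ?g y * (1 - y^2) powr a)
        = continued_integral a ?g"
      by (simp only: integral_mult_right)
    moreover have "(\<lambda>y. 1 / (1 - y^2) * (poly (P n) y)^2 * weight a t y)
        = (\<lambda>y. 1 / (1 - y^2) * ?g y * (1 - y^2) powr a)"
      by (simp add: weight_def fun_eq_iff)
    moreover have "R a t P n = 2 * a / sqnorm a t P n
        * integral {-1..1} (\<lambda>y. 1 / (1 - y^2) * (poly (P n) y)^2 * weight a t y)"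
      using True by (simp only: R_def if_True)
    ultimately show ?thesis by (simp only: times_divide_eq_left)
  qed (simp add: R_def)
  then show ?thesis by (simp only: sq cont)
qed

section \<open>Moments and confluent hypergeometric functions\<close>

lemma pderiv_X_power_Suc: "pderiv (X ^ Suc n) = smult (real (Suc n)) (X ^ n)"
  by (simp only: pderiv_power_Suc) simp

text \<open>
  The Pearson equation at \<open>t = 0\<close>, tested with \<open>x\<^sup>2\<^sup>j\<^sup>+\<^sup>1\<close>.
\<close>

lemma Gegenbauer_moment_Suc:
  assumes "a > -1"
  shows "(2 * real j + 3 + 2 * a) * weighted_integral a 0 (X ^ (2 * Suc j))
       = (2 * real j + 1) * weighted_integral a 0 (X ^ (2 * j))"
proof -
  have "pderiv (X ^ Suc (2 * j)) = smult (2 * real j + 1) (X ^ (2 * j))"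
    by (simp add: pderiv_X_power_Suc add.commute del: power_Suc)
  then have eq: "(1 - X^2) * pderiv (X ^ Suc (2 * j))
      = smult (2 * real j + 1) (X ^ (2 * j) + smult (- 1) (X ^ (2 * Suc j)))"
    by (simp add: algebra_simps power2_eq_square)
  have "weighted_integral a 0
          (smult (2 * real j + 1) (X ^ (2 * j) + smult (- 1) (X ^ (2 * Suc j))))
      = weighted_integral a 0 (smult (2 * (1 + a)) (X ^ (2 * Suc j)))"
    using weighted_integral_pearson[OF assms, of 0 "X ^ Suc (2 * j)"] unfolding eq by simp
  then show ?thesis
    unfolding weighted_integral_add[OF assms] weighted_integral_smult
    by (simp add: algebra_simps)
qed

lemma Gegenbauer_moment:
  assumes "a > -1"
  shows "weighted_integral a 0 (X ^ (2 * (j + k)))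
       = weighted_integral a 0 (X ^ (2 * j))
         * (pochhammer (real j + 1/2) k / pochhammer (real j + 3/2 + a) k)"
proof (induction k)
  case (Suc k)
  have "(real j + 3/2 + a + real k) * weighted_integral a 0 (X ^ (2 * (j + Suc k)))
      = (real j + 1/2 + real k) * weighted_integral a 0 (X ^ (2 * (j + k)))"
    using Gegenbauer_moment_Suc[OF assms, of "j + k"] by (simp add: field_simps)
  moreover have "real j + 3/2 + a + real k > 0" using assms by linarith
  ultimately have eq: "weighted_integral a 0 (X ^ (2 * (j + Suc k)))
      = (real j + 1/2 + real k) / (real j + 3/2 + a + real k)
        * weighted_integral a 0 (X ^ (2 * (j + k)))"
    by (simp add: field_simps)
  show ?case unfolding eq Suc by (simp add: pochhammer_Suc ac_simps)
qed simp

text \<open>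
  Term-by-term integration of the exponential series. The partial sums are dominated by
  \<open>exp \<bar>t\<bar> (1 - x\<^sup>2)\<^sup>a\<close>, since \<open>\<bar>x\<bar> \<le> 1\<close>.
\<close>

lemma moment_sums:
  assumes "a > -1"
  shows "(\<lambda>k. (- t) ^ k / fact k * weighted_integral a 0 (X ^ (2 * (j + k))))
         sums weighted_integral a t (X ^ (2 * j))"
proof -
  let ?w = "\<lambda>x::real. (1 - x^2) powr a"
  let ?f = "\<lambda>n x. \<Sum>k<n. (- t) ^ k / fact k * (poly (X ^ (2 * (j + k))) x * weight a 0 x)"
  let ?g = "\<lambda>x. poly (X ^ (2 * j)) x * weight a t x"
  have f_has: "(?f n has_integral
      (\<Sum>k<n. (- t) ^ k / fact k * weighted_integral a 0 (X ^ (2 * (j + k))))) {-1..1}" for n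
    by (intro has_integral_sum has_integral_mult_right has_integral_weighted_integral assms) auto
  have f_eq: "?f n x = x ^ (2 * j) * ?w x * (\<Sum>k<n. (- t * x^2) ^ k / fact k)" for n x
  proof -
    have "(- t * x^2) ^ k = (- t) ^ k * x ^ (2 * k)" for k
      by (simp only: power_mult_distrib power_mult)
    then show ?thesis by (simp add: sum_distrib_left weight_def power_add ac_simps)
  qed
  have "(\<lambda>n. integral {-1..1} (?f n)) \<longlonglongrightarrow> integral {-1..1} ?g"
  proof (rule dominated_convergence(2)[where h = "\<lambda>x. exp \<bar>t\<bar> * ?w x"])
    show "?f n integrable_on {-1..1}" for n using f_has by (rule has_integral_integrable)
    show "(\<lambda>x. exp \<bar>t\<bar> * ?w x) integrable_on {-1..1}"
      using integrable_mult_weight[OF assms, of "\<lambda>x. exp \<bar>t\<bar>" 0] by (simp add: weight_def)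
  next
    fix n and x :: real assume x: "x \<in> {-1..1}"
    then have x1: "\<bar>x\<bar> \<le> 1" by auto
    then have x2: "x^2 \<le> 1" by (simp add: abs_square_le_1)
    have "\<bar>\<Sum>k<n. (- t * x^2) ^ k / fact k\<bar> \<le> (\<Sum>k<n. \<bar>t * x^2\<bar> ^ k / fact k)"
      by (rule order_trans[OF sum_abs]) (simp add: power_abs abs_mult)
    also have "\<dots> \<le> exp \<bar>t * x^2\<bar>"
      unfolding exp_def using summable_exp_generic[of "\<bar>t * x^2\<bar>"]
      by (intro order_trans[OF sum_le_suminf[where I = "{..<n}"]])
         (auto simp: divide_inverse mult.commute)
    also have "\<dots> \<le> exp \<bar>t\<bar>"
      using x2 by (simp add: abs_mult mult_left_le)
    finally have "\<bar>\<Sum>k<n. (- t * x^2) ^ k / fact k\<bar> \<le> exp \<bar>t\<bar>" .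
    moreover have "\<bar>x ^ (2 * j)\<bar> \<le> 1" using x1 by (simp add: power_abs power_le_one)
    ultimately have "\<bar>x ^ (2 * j)\<bar> * \<bar>\<Sum>k<n. (- t * x^2) ^ k / fact k\<bar> \<le> 1 * exp \<bar>t\<bar>"
      by (intro mult_mono) auto
    then have "?w x * (\<bar>x ^ (2 * j)\<bar> * \<bar>\<Sum>k<n. (- t * x^2) ^ k / fact k\<bar>) \<le> ?w x * exp \<bar>t\<bar>"
      by (intro mult_left_mono) auto
    then show "norm (?f n x) \<le> exp \<bar>t\<bar> * ?w x"
      unfolding f_eq by (simp add: abs_mult ac_simps)
  next
    fix x :: real
    have "(\<lambda>k. (- t * x^2) ^ k / fact k) sums exp (- t * x^2)"
      using exp_converges[of "- t * x^2"] by (simp add: divide_inverse mult.commute)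
    then have "(\<lambda>n. x ^ (2 * j) * ?w x * (\<Sum>k<n. (- t * x^2) ^ k / fact k))
        \<longlonglongrightarrow> x ^ (2 * j) * ?w x * exp (- t * x^2)"
      unfolding sums_def by (intro tendsto_mult tendsto_const)
    then show "(\<lambda>n. ?f n x) \<longlonglongrightarrow> ?g x"
      unfolding f_eq by (simp add: weight_def ac_simps)
  qed
  then show ?thesis
    unfolding sums_def integral_unique[OF f_has] by (simp add: weighted_integral_def)
qed

lemma even_moment_pos:
  assumes "a > -1"
  shows "weighted_integral a t (X ^ (2 * j)) > 0"
proof -
  have "X ^ j \<noteq> 0" by (simp add: X_def)
  then have "weighted_integral a t (X ^ j * X ^ j) > 0"
    by (rule weighted_integral_square_pos[OF assms])
  then show ?thesis by (simp only: mult_2 power_add)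
qed

lemma moment_eq_Kummer:
  assumes "a > -1"
  shows "weighted_integral a t (X ^ (2 * j))
       = weighted_integral a 0 (X ^ (2 * j)) * Kummer (real j + 1/2) (real j + 3/2 + a) (- t)"
proof -
  let ?m = "weighted_integral a 0 (X ^ (2 * j))"
  have m: "?m \<noteq> 0" using even_moment_pos[OF assms, of 0 j] by simp
  have "(\<lambda>k. ?m * (pochhammer (real j + 1/2) k / pochhammer (real j + 3/2 + a) k
            * ((- t) ^ k / fact k))) sums weighted_integral a t (X ^ (2 * j))"
    using moment_sums[OF assms, of t j] unfolding Gegenbauer_moment[OF assms]
    by (simp add: ac_simps)
  then have "(\<lambda>k. pochhammer (real j + 1/2) k / pochhammer (real j + 3/2 + a) k
            * ((- t) ^ k / fact k)) sums (weighted_integral a t (X ^ (2 * j)) / ?m)"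
    using m by (drule_tac sums_mult[where c = "1 / ?m"]) simp
  then have "Kummer (real j + 1/2) (real j + 3/2 + a) (- t)
      = weighted_integral a t (X ^ (2 * j)) / ?m"
    unfolding Kummer_def by (rule sums_unique[symmetric])
  then show ?thesis using m by simp
qed

text \<open>
  The left-hand side is the integral of \<open>(1 + 2a) g + x g' - 2t x\<^sup>2 g\<close> for
  \<open>g = x\<^sup>2\<^sup>j\<close>. In terms of the expansion in powers of \<open>- t\<close> it multiplies the
  \<open>k\<close>-th coefficient by \<open>2 (c + k)\<close> with \<open>c = j + 1/2 + a\<close>, which lowers the second
  Kummer parameter from \<open>c + 1\<close> to \<open>c\<close>.
\<close>

lemma moment_combination_eq_Kummer:
  assumes a: "a > -1" and c0: "2 * real j + 1 + 2 * a \<noteq> 0"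
  shows "(2 * real j + 1 + 2 * a) * weighted_integral a t (X ^ (2 * j))
         - 2 * t * weighted_integral a t (X ^ (2 * Suc j))
       = (2 * real j + 1 + 2 * a) * weighted_integral a 0 (X ^ (2 * j))
         * Kummer (real j + 1/2) (real j + 1/2 + a) (- t)"
proof -
  define m where "m = (\<lambda>k. weighted_integral a 0 (X ^ (2 * k)))"
  define c where "c = real j + 1/2 + a"
  let ?M = "\<lambda>j. weighted_integral a t (X ^ (2 * j))"
  have c: "c \<noteq> 0" "c + 1 > 0" "2 * real j + 1 + 2 * a = 2 * c" using a c0 by (auto simp: c_def)
  have mj: "m j \<noteq> 0" using even_moment_pos[OF a, of 0 j] by (simp add: m_def)
  have "(\<lambda>k. 2 * (- t) * ((- t) ^ k / fact k * m (Suc j + k))) sums (2 * (- t) * ?M (Suc j))"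
    using moment_sums[OF a, of t "Suc j"] unfolding m_def by (rule sums_mult)
  also have "(\<lambda>k. 2 * (- t) * ((- t) ^ k / fact k * m (Suc j + k)))
      = (\<lambda>k. 2 * real (Suc k) * ((- t) ^ Suc k / fact (Suc k) * m (j + Suc k)))"
    by (rule ext) (simp add: field_simps del: of_nat_Suc)
  \<comment> \<open>the factor \<open>k\<close> annihilates the term at \<open>k = 0\<close>, so the shifted series starts at \<open>0\<close>\<close>
  finally have "(\<lambda>k. 2 * real k * ((- t) ^ k / fact k * m (j + k))) sums (2 * (- t) * ?M (Suc j))"
    using sums_Suc[of "\<lambda>k. 2 * real k * ((- t) ^ k / fact k * m (j + k))"] by simp
  moreover have "(\<lambda>k. 2 * c * ((- t) ^ k / fact k * m (j + k))) sums (2 * c * ?M j)"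
    using moment_sums[OF a, of t j] unfolding m_def by (rule sums_mult)
  ultimately have "(\<lambda>k. 2 * real k * ((- t) ^ k / fact k * m (j + k))
        + 2 * c * ((- t) ^ k / fact k * m (j + k))) sums (2 * (- t) * ?M (Suc j) + 2 * c * ?M j)"
    by (rule sums_add)
  also have "(\<lambda>k. 2 * real k * ((- t) ^ k / fact k * m (j + k))
        + 2 * c * ((- t) ^ k / fact k * m (j + k)))
      = (\<lambda>k. 2 * (c + real k) * ((- t) ^ k / fact k * m (j + k)))"
    by (simp only: distrib_left distrib_right add.commute)
  also have "2 * (- t) * ?M (Suc j) + 2 * c * ?M j = 2 * c * ?M j - 2 * t * ?M (Suc j)"
    by simp
  also have "(\<lambda>k. 2 * (c + real k) * ((- t) ^ k / fact k * m (j + k)))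
     = (\<lambda>k. 2 * c * m j * (pochhammer (real j + 1/2) k / pochhammer c k * ((- t) ^ k / fact k)))"
  proof
    fix k
    have poch: "pochhammer c k * (c + real k) = c * pochhammer (c + 1) k"
      using pochhammer_Suc[of c k] pochhammer_rec[of c k] by simp
    have pos: "pochhammer (c + 1) k > 0" using c(2) by (rule pochhammer_pos)
    have "pochhammer c k \<noteq> 0" using poch pos c(1) by auto
    then have ratio: "(c + real k) / pochhammer (c + 1) k = c / pochhammer c k"
      using poch pos by (simp add: field_simps)
    have mjk: "m (j + k) = m j * (pochhammer (real j + 1/2) k / pochhammer (c + 1) k)"
      using Gegenbauer_moment[OF a, of j k] by (simp add: m_def c_def add_ac)
    have "2 * (c + real k) * ((- t) ^ k / fact k * m (j + k))
        = 2 * m j * pochhammer (real j + 1/2) k * ((- t) ^ k / fact k)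
          * ((c + real k) / pochhammer (c + 1) k)"
      unfolding mjk by simp
    also have "\<dots> = 2 * m j * pochhammer (real j + 1/2) k * ((- t) ^ k / fact k)
          * (c / pochhammer c k)"
      by (simp only: ratio)
    finally show "2 * (c + real k) * ((- t) ^ k / fact k * m (j + k))
      = 2 * c * m j * (pochhammer (real j + 1/2) k / pochhammer c k * ((- t) ^ k / fact k))"
      by (simp add: ac_simps)
  qed
  finally have sums: "(\<lambda>k. 2 * c * m j * (pochhammer (real j + 1/2) k / pochhammer c k
      * ((- t) ^ k / fact k))) sums (2 * c * ?M j - 2 * t * ?M (Suc j))" .
  have "Kummer (real j + 1/2) c (- t) = (2 * c * ?M j - 2 * t * ?M (Suc j)) / (2 * c * m j)"
    unfolding Kummer_def
    using sums_mult[OF sums, of "1 / (2 * c * m j)"] c(1) mj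
    by (intro sums_unique[symmetric]) simp
  then show ?thesis using c mj by (simp add: m_def flip: c_def)
qed

theorem theorem5p2:
  fixes \<alpha> t :: real and P :: "nat \<Rightarrow> real poly" and Hn :: "nat \<Rightarrow> real"
  assumes "\<alpha> > -1"
    and "monic_orthogonal \<alpha> t P"
    and "\<And>n. Hn n = H \<alpha> t P n"
  shows "(\<forall>n\<ge>1.
      0 = (2*t + Hn n - Hn (n-1))^2 * (2*t + Hn (n+1) - Hn n)^2
            * (Hn n + real n * Hn (n-1) - real n * Hn (n+1))
        + (real n * (2*t + Hn n - Hn (n-1)) * (2*t + Hn (n+1) - Hn n)
             - 2*t * (2 * real n * t + Hn n))
          * ((2*t + Hn n - Hn (n-1)) * (2*t + Hn (n+1) - Hn n)
               * (2*t - real n - 2*\<alpha> + Hn (n+1) - Hn (n-1))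
             + 2*t * (2 * real n * t + Hn n)))
    \<and> (\<alpha> \<noteq> -1/2 \<longrightarrow>
        Hn 1 = (1 + 2*\<alpha>) * Kummer (1/2) (1/2 + \<alpha>) (-t) / Kummer (1/2) (3/2 + \<alpha>) (-t)
      \<and> Hn 2 = (1 + 2*\<alpha>) * Kummer (1/2) (1/2 + \<alpha>) (-t) / Kummer (1/2) (3/2 + \<alpha>) (-t)
             + (3 + 2*\<alpha>) * Kummer (3/2) (3/2 + \<alpha>) (-t) / Kummer (3/2) (5/2 + \<alpha>) (-t))"
proof -
  note \<alpha> = assms(1)
  interpret W: even_pearson_functional "weighted_integral \<alpha> t" P \<alpha> t
    by (rule even_pearson_functional_weighted_integral) fact+
  define Z where "Z = (\<lambda>n. 2 * real n + 1 + 2 * \<alpha> + 2 * t - 2 * t * (W.b n + W.b (Suc n)))"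
  have H_0: "Hn 0 = 0" and H_Suc: "Hn (Suc n) = Hn n + R \<alpha> t P n" for n
    by (simp_all add: assms(3) H_def)
  have R_eq: "R \<alpha> t P n = Z n - 2 * t" for n
    using W.h_nonzero[of n]
    unfolding R_eq_weighted_integral[OF \<alpha>] W.L_continued_integrand
    by (simp add: W.h_def Z_def)
  have diff_eq: "0 = (2*t + Hn n - Hn (n-1))^2 * (2*t + Hn (n+1) - Hn n)^2
            * (Hn n + real n * Hn (n-1) - real n * Hn (n+1))
        + (real n * (2*t + Hn n - Hn (n-1)) * (2*t + Hn (n+1) - Hn n)
             - 2*t * (2 * real n * t + Hn n))
          * ((2*t + Hn n - Hn (n-1)) * (2*t + Hn (n+1) - Hn n)
               * (2*t - real n - 2*\<alpha> + Hn (n+1) - Hn (n-1))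
             + 2*t * (2 * real n * t + Hn n))" if "n \<ge> 1" for n
  proof -
    have prods: "2 * real n * t + Hn n = W.b n * Z n * Z (n - 1)"
      "(real n - 2 * t * W.b n) * (real n - 2 * t * W.b n + 2 * \<alpha>)
         = W.b n * (Z n - 2 * t) * (Z (n - 1) - 2 * t)"
      using product_identities_from_recurrence[of W.b Hn \<alpha> t n]
        W.recurrence_coefficients_equation H_0 H_Suc R_eq
      unfolding Z_def by (simp_all add: W.b_def)
    have X: "2*t + Hn n - Hn (n-1) = Z (n-1)" and Y: "2*t + Hn (n+1) - Hn n = Z n"
      using H_Suc[of "n - 1"] H_Suc[of n] R_eq[of n] R_eq[of "n - 1"] that by simp_all
    have 1: "Hn n + real n * Hn (n-1) - real n * Hn (n+1)
        = Hn n - real n * (Z (n-1) + Z n - 4 * t)"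
      and 2: "2*t - real n - 2*\<alpha> + Hn (n+1) - Hn (n-1)
        = Z (n-1) + Z n - 2 * t - real n - 2 * \<alpha>"
      unfolding X[symmetric] Y[symmetric] by (simp_all add: algebra_simps)
    show ?thesis
      unfolding X Y 1 2 using difference_equation_from_products[OF prods] by simp
  qed
  have R_Kummer: "R \<alpha> t P j = (2 * real j + 1 + 2 * \<alpha>)
      * Kummer (real j + 1/2) (real j + 1/2 + \<alpha>) (-t) / Kummer (real j + 1/2) (real j + 3/2 + \<alpha>) (-t)"
    if "P j = X ^ j" "2 * real j + 1 + 2 * \<alpha> \<noteq> 0" for j
  proof -
    have PP: "P j * P j = X ^ (2 * j)" using that(1) by (simp add: mult_2 power_add)
    have XD: "X * pderiv (X ^ (2 * j)) = smult (2 * real j) (X ^ (2 * j))"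
      using pderiv_X_power_Suc[of "2 * j - 1"] by (cases j) simp_all
    have "smult (1 + 2 * \<alpha>) (P j * P j) + X * pderiv (P j * P j)
            - smult (2 * t) (X^2 * P j * P j)
        = smult (2 * real j + 1 + 2 * \<alpha>) (X ^ (2 * j)) - smult (2 * t) (X ^ (2 * Suc j))"
      unfolding mult.assoc PP XD
      by (simp add: smult_add_left power_add power2_eq_square ac_simps)
    then have "R \<alpha> t P j = ((2 * real j + 1 + 2 * \<alpha>) * weighted_integral \<alpha> t (X ^ (2 * j))
          - 2 * t * weighted_integral \<alpha> t (X ^ (2 * Suc j))) / weighted_integral \<alpha> t (X ^ (2 * j))"
      unfolding R_eq_weighted_integral[OF \<alpha>] by (simp only: PP W.L_linear)
    then have "R \<alpha> t P j = (2 * real j + 1 + 2 * \<alpha>) * weighted_integral \<alpha> 0 (X ^ (2 * j))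
          * Kummer (real j + 1/2) (real j + 1/2 + \<alpha>) (-t) / weighted_integral \<alpha> t (X ^ (2 * j))"
      by (simp only: moment_combination_eq_Kummer[OF \<alpha> that(2)])
    then show ?thesis
      unfolding moment_eq_Kummer[OF \<alpha>, of t j]
      using even_moment_pos[OF \<alpha>, of 0 j] by simp
  qed
  have P0: "P 0 = X ^ 0"
  proof -
    obtain c where "P 0 = [:c:]" using W.degree_P[of 0] by (rule degree_eq_zeroE)
    then show ?thesis using W.lead_coeff_P[of 0] by simp
  qed
  have P1: "P 1 = X ^ 1"
    using W.three_term_recurrence[of 0] P0 by (simp add: W.b_def)
  have R0: "R \<alpha> t P 0 = (1 + 2*\<alpha>) * Kummer (1/2) (1/2 + \<alpha>) (-t) / Kummer (1/2) (3/2 + \<alpha>) (-t)"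
    if "\<alpha> \<noteq> -1/2"
    using R_Kummer[OF P0] that by simp
  have R1: "R \<alpha> t P 1 = (3 + 2*\<alpha>) * Kummer (3/2) (3/2 + \<alpha>) (-t) / Kummer (3/2) (5/2 + \<alpha>) (-t)"
    using R_Kummer[OF P1] \<alpha> by simp
  have H1: "Hn 1 = R \<alpha> t P 0" and H2: "Hn 2 = R \<alpha> t P 0 + R \<alpha> t P 1"
    using H_0 H_Suc[of 0] H_Suc[of 1] by (simp_all add: numeral_2_eq_2)
  show ?thesis
    unfolding H1 H2 using R0 by (intro conjI allI impI diff_eq) (simp_all only: R1 not_False_eq_True)
qed

end
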